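(* Let $c\in(0,\sqrt{2})$ and $\xi\in(0,c^4/4)$. Then the problem $$z^{(4)}+c^2 z''+(z+1)^{+}-\xi (z+1)^{-}-1=0 \ \text{ on } \mathbb{R},\qquad z(t),\,z'(t)\to 0 \ \text{ as } |t|\to+\infty,$$ has at most $6$ even one-troughed solutions. Equivalently, for $a>b>0$ with $b/a\in(0,c^4/4)$, the problem $$u_{\tau\tau}+u_{xxxx}+a u^+-b u^-=1 \ (x\in\mathbb{R},\ \tau>0),\qquad u(x,\tau)\to \tfrac1a,\ u_x(x,\tau)\to 0 \text{ as } |x|\to\infty,$$ has at most $6$ even one-troughed travelling wave solutions with wave-speed parameter $c$.
   Context: Here $s^{+}=\max\{s,0\}$, $s^{-}=\max\{-s,0\}$. Travelling waves of the PDE problem are functions of the form $u(x,\tau)=\frac1a\bigl(1+z(\sqrt[4]{a}\,x-c\sqrt{a}\,\tau)\bigr)$; under this substitution the PDE problem becomes the ODE problem above with $\xi=b/a$. A solution $z$ is a $C^4$ function on $\mathbb{R}$ satisfying the ODE and the decay conditions. A solution $z$ is called even if $z(-t)=z(t)$ for all $t$, and one-troughed if there are exactly two points $t\in\mathbb{R}$ with $z(t)=-1$ (so that $z$ drops below $-1$ on exactly one interval). The corresponding travelling wave is called even/one-troughed accordingly. *)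

theory Defs
  imports "HOL-Analysis.Analysis"
begin

definition pos_part :: "real \<Rightarrow> real" where "pos_part s = max s 0"
definition neg_part :: "real \<Rightarrow> real" where "neg_part s = max (- s) 0"

definition C4 :: "(real \<Rightarrow> real) \<Rightarrow> bool" where
  "C4 z \<longleftrightarrow> (\<forall>k<4. \<forall>t. ((deriv ^^ k) z) differentiable (at t))
              \<and> continuous_on UNIV ((deriv ^^ 4) z)"

definition tw_solution :: "real \<Rightarrow> real \<Rightarrow> (real \<Rightarrow> real) \<Rightarrow> bool" where
  "tw_solution c \<xi> z \<longleftrightarrow> C4 z
     \<and> (\<forall>t. (deriv ^^ 4) z t + c\<^sup>2 * (deriv ^^ 2) z t + pos_part (z t + 1)
              - \<xi> * neg_part (z t + 1) - 1 = 0)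
     \<and> (z \<longlongrightarrow> 0) at_top \<and> (z \<longlongrightarrow> 0) at_bot
     \<and> (deriv z \<longlongrightarrow> 0) at_top \<and> (deriv z \<longlongrightarrow> 0) at_bot"

definition even_fun :: "(real \<Rightarrow> real) \<Rightarrow> bool" where
  "even_fun z \<longleftrightarrow> (\<forall>t. z (- t) = z t)"

definition one_troughed :: "(real \<Rightarrow> real) \<Rightarrow> bool" where
  "one_troughed z \<longleftrightarrow> card {t. z t = -1} = 2"

end

theory Submission
  imports Defs
begin

text \<open>
  Let \<open>\<plusminus>T\<close> be the points where \<open>z = -1\<close> and \<open>v = z'(T)\<close>. Beyond \<open>T\<close> the equation is linear and
  decay forces \<open>z'' + 2 p z' + z = 0\<close> with \<open>4 p\<^sup>2 = 2 - c\<^sup>2\<close>; inside the trough \<open>z\<close> is a constant plus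
  \<open>cos (\<alpha> t)\<close> and \<open>cos (\<beta> t)\<close> modes, where \<open>\<alpha> < \<beta>\<close>, \<open>\<alpha>\<^sup>2 + \<beta>\<^sup>2 = c\<^sup>2\<close>, \<open>\<alpha>\<^sup>2 \<beta>\<^sup>2 = \<xi>\<close>.
  Matching at \<open>T\<close> gives \<open>tan (\<alpha> T + \<delta>) = \<alpha> v\<close> and \<open>tan (\<beta> T + \<epsilon>) = \<beta> v\<close> for explicit phases
  \<open>\<delta>\<close>, \<open>\<epsilon>\<close>. Testing the equation \<open>z'' + \<beta>\<^sup>2 (z + 1) = 1/\<alpha>\<^sup>2 + a cos (\<alpha> t)\<close> against half a period of
  a cosine of frequency \<open>\<beta>\<close>, the sign of \<open>z + 1\<close> in the trough leaves only the branch
  \<open>\<alpha> T + \<delta> = arctan (\<alpha> v)\<close>, while \<open>\<beta> T + \<epsilon> = arctan (\<beta> v) + k \<pi>\<close> for some \<open>k \<ge> 0\<close>.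
  Since \<open>arctan (\<alpha> v) / \<alpha> - arctan (\<beta> v) / \<beta>\<close> is strictly increasing in \<open>v\<close>, the number \<open>k\<close>
  determines \<open>v\<close>, hence \<open>T\<close> and \<open>z\<close>. Finally, the damped tail must not return to \<open>-1\<close>; evaluating it
  at phase \<open>5 \<pi> / 4\<close> bounds \<open>v\<close> in terms of \<open>p\<close>, and this yields \<open>k \<le> 5\<close>.
\<close>


section \<open>Damped, decaying and forced linear oscillators\<close>

text \<open>In the coordinates \<open>y\<close> and \<open>(y1 - m * y) / q\<close> the flow is a
  rotation of speed \<open>q\<close> combined with exponential scaling of rate \<open>m\<close>.
  Both coordinates are recorded, because matching at the edge of the trough also uses the
  derivative.\<close>

lemma damped_oscillator:
  fixes y y1 y2 :: "real \<Rightarrow> real"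
  assumes y: "\<And>t. (y has_real_derivative y1 t) (at t)"
    and y1: "\<And>t. (y1 has_real_derivative y2 t) (at t)"
    and ode: "\<And>t. a \<le> t \<Longrightarrow> t \<le> b \<Longrightarrow> y2 t = 2 * m * y1 t - (m\<^sup>2 + q\<^sup>2) * y t"
    and q: "q \<noteq> 0" and t: "a \<le> t" "t \<le> b"
  shows "y t = exp (m * (t - a)) * (y a * cos (q * (t - a)) + (y1 a - m * y a) / q * sin (q * (t - a)))"
    and "(y1 t - m * y t) / q =
      exp (m * (t - a)) * ((y1 a - m * y a) / q * cos (q * (t - a)) - y a * sin (q * (t - a)))"
proof -
  define Y where "Y = (\<lambda>s. (y1 s - m * y s) / q)"
  \<comment> \<open>\<open>F\<close> and \<open>G\<close> undo the rotation and the scaling, so they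
    are constant along a solution.\<close>
  define F where "F = (\<lambda>s. exp (- m * (s - a)) * (y s * cos (q * (s - a)) - Y s * sin (q * (s - a))))"
  define G where "G = (\<lambda>s. exp (- m * (s - a)) * (y s * sin (q * (s - a)) + Y s * cos (q * (s - a))))"
  have Y: "(Y has_real_derivative (y2 s - m * y1 s) / q) (at s)" for s
    unfolding Y_def using q by (auto intro!: derivative_eq_intros y y1 simp: field_simps)
  have y': "y1 s = q * Y s + m * y s" for s
    using q by (simp add: Y_def)
  have Y': "(y2 s - m * y1 s) / q = m * Y s - q * y s" if "a \<le> s" "s \<le> b" for s
    using q ode[OF that] by (simp add: Y_def field_simps power2_eq_square)
  have F': "(F has_real_derivative exp (- m * (s - a)) *
      (- m * (y s * cos (q * (s - a)) - Y s * sin (q * (s - a))) + y1 s * cos (q * (s - a))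
       - q * y s * sin (q * (s - a)) - (y2 s - m * y1 s) / q * sin (q * (s - a))
       - q * Y s * cos (q * (s - a)))) (at s)" for s
    unfolding F_def by (auto intro!: derivative_eq_intros y Y simp: algebra_simps)
  have G': "(G has_real_derivative exp (- m * (s - a)) *
      (- m * (y s * sin (q * (s - a)) + Y s * cos (q * (s - a))) + y1 s * sin (q * (s - a))
       + q * y s * cos (q * (s - a)) + (y2 s - m * y1 s) / q * cos (q * (s - a))
       - q * Y s * sin (q * (s - a)))) (at s)" for s
    unfolding G_def by (auto intro!: derivative_eq_intros y Y simp: algebra_simps)
  have F0: "(F has_real_derivative 0) (at s)" if "a \<le> s" "s \<le> b" for s
    using F'[of s] unfolding Y'[OF that] unfolding y'[of s] by (simp add: algebra_simps)
  have G0: "(G has_real_derivative 0) (at s)" if "a \<le> s" "s \<le> b" for s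
    using G'[of s] unfolding Y'[OF that] unfolding y'[of s] by (simp add: algebra_simps)
  have const: "H t = H a" if "\<And>s. a \<le> s \<Longrightarrow> s \<le> b \<Longrightarrow> (H has_real_derivative 0) (at s)" for H
  proof (cases "a = t")
    case False
    show ?thesis
    proof (rule DERIV_isconst_end[where f = H])
      show "continuous_on {a..t} H"
        using that t by (intro DERIV_atLeastAtMost_imp_continuous_on) force
    qed (use False t that in auto)
  qed simp
  have F: "F t = y a" and G: "G t = Y a"
    using const[OF F0] const[OF G0] by (auto simp: F_def G_def)
  let ?C = "cos (q * (t - a))" and ?S = "sin (q * (t - a))"
  have e: "exp (m * (t - a)) * exp (- m * (t - a)) = 1"
    by (simp flip: exp_add)
  have sc: "?S\<^sup>2 + ?C\<^sup>2 = 1" by simp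
  have ring: "E * (H * (u * C - U * S) * C + H * (u * S + U * C) * S) = E * H * (u * (S\<^sup>2 + C\<^sup>2))"
      "E * (H * (u * S + U * C) * C - H * (u * C - U * S) * S) = E * H * (U * (S\<^sup>2 + C\<^sup>2))"
    for E H u U C S :: real
    by (simp_all add: algebra_simps power2_eq_square)
  have "exp (m * (t - a)) * (F t * ?C + G t * ?S)
      = (exp (m * (t - a)) * exp (- m * (t - a))) * (y t * (?S\<^sup>2 + ?C\<^sup>2))"
    unfolding F_def G_def by (rule ring(1))
  then show "y t = exp (m * (t - a)) * (y a * ?C + (y1 a - m * y a) / q * ?S)"
    unfolding F G e sc by (simp add: Y_def)
  have "exp (m * (t - a)) * (G t * ?C - F t * ?S)
      = (exp (m * (t - a)) * exp (- m * (t - a))) * (Y t * (?S\<^sup>2 + ?C\<^sup>2))"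
    unfolding F_def G_def by (rule ring(2))
  then show "(y1 t - m * y t) / q =
      exp (m * (t - a)) * ((y1 a - m * y a) / q * ?C - y a * ?S)"
    unfolding F G e sc by (simp add: Y_def)
qed

text \<open>Sampling at times whose phase is \<open>0\<close>, respectively \<open>pi / 2\<close>,
  modulo \<open>2 * pi\<close> isolates \<open>A\<close> and \<open>B\<close>.\<close>

lemma trig_combination_tendsto_0:
  fixes A B q :: real
  assumes q: "q > 0" and lim: "((\<lambda>t. A * cos (q * t) + B * sin (q * t)) \<longlongrightarrow> 0) at_top"
  shows "A = 0" "B = 0"
proof -
  have seq: "(\<lambda>n. A * cos (q * ((\<phi> + 2 * pi * real n) / q)) + B * sin (q * ((\<phi> + 2 * pi * real n) / q)))
      \<longlonglongrightarrow> 0" for \<phi>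
  proof (rule filterlim_compose[OF lim])
    have "filterlim (\<lambda>n. \<phi> / q + 2 * pi / q * real n) at_top sequentially"
      using q by (intro filterlim_tendsto_add_at_top[OF tendsto_const]
          filterlim_tendsto_pos_mult_at_top[OF tendsto_const] filterlim_real_sequentially) auto
    then show "filterlim (\<lambda>n. (\<phi> + 2 * pi * real n) / q) at_top sequentially"
      by (simp add: add_divide_distrib)
  qed
  have per: "cos (\<phi> + 2 * pi * real n) = cos \<phi>" "sin (\<phi> + 2 * pi * real n) = sin \<phi>" for \<phi> n
    using sin_cos_eq_iff[of "\<phi> + 2 * pi * real n" \<phi>] by (auto intro: exI[of _ "int n"])
  show "A = 0" "B = 0"
    using seq[of 0] seq[of "pi / 2"] q per[of 0] per[of "pi / 2"] by (auto simp: LIMSEQ_const_iff)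
qed

text \<open>With D for differentiation, D^4 + (2 - 4 p^2) D^2 + 1 = (D^2 + 2 p D + 1) (D^2 - 2 p D +
  1). Applying the first factor to \<open>z\<close> gives a solution of the second, whose amplitude
  grows like exp (p t); decay of \<open>z1\<close> forces it to vanish.\<close>

lemma decaying_solution_factor:
  fixes z z1 z2 z3 z4 :: "real \<Rightarrow> real"
  assumes d: "\<And>t. (z has_real_derivative z1 t) (at t)" "\<And>t. (z1 has_real_derivative z2 t) (at t)"
      "\<And>t. (z2 has_real_derivative z3 t) (at t)" "\<And>t. (z3 has_real_derivative z4 t) (at t)"
    and ode: "\<And>t. T \<le> t \<Longrightarrow> z4 t + (2 - 4 * p\<^sup>2) * z2 t + z t = 0"
    and pq: "p > 0" "q > 0" "p\<^sup>2 + q\<^sup>2 = 1"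
    and lim: "(z1 \<longlongrightarrow> 0) at_top"
  shows "z2 T + 2 * p * z1 T + z T = 0" "z3 T + 2 * p * z2 T + z1 T = 0"
proof -
  define f where "f = (\<lambda>m t. z2 t + 2 * m * z1 t + z t)"
  define f1 where "f1 = (\<lambda>m t. z3 t + 2 * m * z2 t + z1 t)"
  \<comment> \<open>\<open>m = p\<close> gives the growing part and \<open>m = - p\<close> the
    decaying one.\<close>
  have f: "f m t = exp (m * (t - T)) * (f m T * cos (q * (t - T)) + (f1 m T - m * f m T) / q * sin (q * (t - T)))"
    if m: "m\<^sup>2 = p\<^sup>2" and t: "T \<le> t" for m t
  proof (rule damped_oscillator(1)[where y = "f m" and a = T and ?y1.0 = "f1 m" and ?y2.0 = "\<lambda>t. z4 t + 2 * m * z3 t + z2 t" and b = t])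
    show "z4 s + 2 * m * z3 s + z2 s = 2 * m * f1 m s - (m\<^sup>2 + q\<^sup>2) * f m s" if "T \<le> s" "s \<le> t" for s
    proof -
      have "2 * m * f1 m s - (m\<^sup>2 + q\<^sup>2) * f m s = 2 * m * z3 s + (4 * m\<^sup>2 - 1) * z2 s - z s"
        using m pq by (simp add: f_def f1_def algebra_simps power2_eq_square)
      then show ?thesis
        using ode[OF that(1)] m by (simp add: algebra_simps)
    qed
  qed (use pq t in \<open>auto simp: f_def f1_def intro!: derivative_eq_intros d\<close>)
  define A B where "A = f p T" and "B = (f1 p T - p * f p T) / q"
  define C D where "C = f (- p) T" and "D = (f1 (- p) T + p * f (- p) T) / q"
  have z1: "4 * p * z1 (T + s) = exp (p * s) * (A * cos (q * s) + B * sin (q * s))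
      - exp (- p * s) * (C * cos (q * s) + D * sin (q * s))" if "s \<ge> 0" for s
  proof -
    have "4 * p * z1 (T + s) = f p (T + s) - f (- p) (T + s)"
      by (simp add: f_def)
    then show ?thesis
      using f[of p "T + s"] f[of "- p" "T + s"] that by (simp add: A_def B_def C_def D_def)
  qed
  \<comment> \<open>Multiplication by \<open>exp (- p * s)\<close> isolates the trigonometric part
    of the growing mode; both terms on the right tend to 0.\<close>
  have eq: "A * cos (q * s) + B * sin (q * s) =
      exp (- p * s) * (4 * p * z1 (T + s)) + exp (- (2 * p) * s) * (C * cos (q * s) + D * sin (q * s))"
    if "s \<ge> 0" for s
  proof -
    have e: "exp (- (2 * p) * s) = exp (- p * s) * exp (- p * s)" "exp (- p * s) * exp (p * s) = 1"
      by (simp_all flip: exp_add)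
    have "F * (E * X - F * Y) + F * F * Y = F * E * X" for E F X Y :: real
      by (simp add: algebra_simps)
    then show ?thesis
      unfolding z1[OF that] e(1) by (metis e(2) mult_1)
  qed
  have e: "((\<lambda>s. exp (- k * s)) \<longlongrightarrow> 0) at_top" if "k > 0" for k :: real
    using that by (intro filterlim_compose[OF exp_at_bot]
      filterlim_tendsto_neg_mult_at_bot[OF tendsto_const _ filterlim_ident]) auto
  have "((\<lambda>s. z1 (T + s)) \<longlongrightarrow> 0) at_top"
    by (rule filterlim_compose[OF lim])
      (intro filterlim_tendsto_add_at_top[OF tendsto_const] filterlim_ident)
  then have l1: "((\<lambda>s. exp (- p * s) * (4 * p * z1 (T + s))) \<longlongrightarrow> 0 * (4 * p * 0)) at_top"
    using pq by (intro tendsto_intros e)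
  have l2: "((\<lambda>s. exp (- (2 * p) * s) * (C * cos (q * s) + D * sin (q * s))) \<longlongrightarrow> 0) at_top"
  proof (rule Lim_null_comparison)
    show "\<forall>\<^sub>F s in at_top. norm (exp (- (2 * p) * s) * (C * cos (q * s) + D * sin (q * s)))
        \<le> exp (- (2 * p) * s) * (\<bar>C\<bar> + \<bar>D\<bar>)"
    proof (intro always_eventually allI)
      fix s
      have "\<bar>C * cos (q * s) + D * sin (q * s)\<bar> \<le> \<bar>C\<bar> * \<bar>cos (q * s)\<bar> + \<bar>D\<bar> * \<bar>sin (q * s)\<bar>"
        by (metis abs_mult abs_triangle_ineq)
      also have "\<dots> \<le> \<bar>C\<bar> * 1 + \<bar>D\<bar> * 1"
        by (intro add_mono mult_left_mono) auto
      finally show "norm (exp (- (2 * p) * s) * (C * cos (q * s) + D * sin (q * s)))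
        \<le> exp (- (2 * p) * s) * (\<bar>C\<bar> + \<bar>D\<bar>)"
        by (simp add: abs_mult)
    qed
    have "((\<lambda>s. exp (- (2 * p) * s) * (\<bar>C\<bar> + \<bar>D\<bar>)) \<longlongrightarrow> 0 * (\<bar>C\<bar> + \<bar>D\<bar>)) at_top"
      using pq by (intro tendsto_intros e) auto
    then show "((\<lambda>s. exp (- (2 * p) * s) * (\<bar>C\<bar> + \<bar>D\<bar>)) \<longlongrightarrow> 0) at_top" by simp
  qed
  have "((\<lambda>s. A * cos (q * s) + B * sin (q * s)) \<longlongrightarrow> 0) at_top"
  proof (rule Lim_transform_eventually)
    show "((\<lambda>s. exp (- p * s) * (4 * p * z1 (T + s)) +
        exp (- (2 * p) * s) * (C * cos (q * s) + D * sin (q * s))) \<longlongrightarrow> 0) at_top"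
      using tendsto_add[OF l1 l2] by simp
    show "\<forall>\<^sub>F s in at_top. exp (- p * s) * (4 * p * z1 (T + s)) +
        exp (- (2 * p) * s) * (C * cos (q * s) + D * sin (q * s)) = A * cos (q * s) + B * sin (q * s)"
      using eventually_ge_at_top[of 0] by eventually_elim (simp add: eq)
  qed
  from trig_combination_tendsto_0[OF pq(2) this] have "A = 0" "B = 0" .
  then show "z2 T + 2 * p * z1 T + z T = 0" "z3 T + 2 * p * z2 T + z1 T = 0"
    using pq by (auto simp: A_def B_def f_def f1_def)
qed

text \<open>The cosine \<open>cos (w * (t - s))\<close> is positive on the half period around
  \<open>s\<close> and vanishes at its ends, so testing u'' + w^2 u against it leaves only the end
  values of \<open>u\<close>. The function \<open>\<Phi>\<close> is the explicit antiderivative of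
  the product.\<close>

lemma forced_oscillator_positive_half_period:
  fixes u u1 u2 :: "real \<Rightarrow> real"
  assumes u: "\<And>t. (u has_real_derivative u1 t) (at t)" "\<And>t. (u1 has_real_derivative u2 t) (at t)"
    and w: "w > 0"
    and pos: "\<And>t. \<bar>t - s\<bar> < pi / (2 * w) \<Longrightarrow> u2 t + w\<^sup>2 * u t > 0"
  shows "u (s - pi / (2 * w)) + u (s + pi / (2 * w)) > 0"
proof -
  define \<Phi> where "\<Phi> = (\<lambda>t. u1 t * cos (w * (t - s)) + w * u t * sin (w * (t - s)))"
  have \<Phi>': "(\<Phi> has_real_derivative (u2 t + w\<^sup>2 * u t) * cos (w * (t - s))) (at t)" for t
    unfolding \<Phi>_def by (auto intro!: derivative_eq_intros u simp: algebra_simps power2_eq_square)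
  have "\<Phi> (s - pi / (2 * w)) < \<Phi> (s + pi / (2 * w))"
  proof (rule DERIV_pos_imp_increasing_open[where f = \<Phi>])
    fix t assume t: "s - pi / (2 * w) < t" "t < s + pi / (2 * w)"
    then have "- (pi / 2) < w * (t - s)" "w * (t - s) < pi / 2"
      using w by (auto simp: field_simps)
    then have "cos (w * (t - s)) > 0" by (rule cos_gt_zero_pi)
    moreover have "u2 t + w\<^sup>2 * u t > 0"
      using t by (intro pos) (simp add: abs_less_iff)
    ultimately show "\<exists>y. (\<Phi> has_real_derivative y) (at t) \<and> 0 < y"
      using \<Phi>'[of t] by (meson mult_pos_pos)
  next
    show "continuous_on {s - pi / (2 * w)..s + pi / (2 * w)} \<Phi>"
      using \<Phi>' by (intro DERIV_atLeastAtMost_imp_continuous_on) blast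
  qed (use w in simp)
  then have "0 < w * (u (s - pi / (2 * w)) + u (s + pi / (2 * w)))"
    using w by (simp add: \<Phi>_def algebra_simps)
  then show ?thesis using w by (simp add: zero_less_mult_iff)
qed

section \<open>Numerical estimates for the length of the trough\<close>

lemma exp_upper_bounds: "exp (3.262::real) < 26.39" "exp (3.05::real) < 21.2"
proof -
  have e: "exp (1::real) ^ 3 \<le> (5837465778 / 2147483648) ^ 3"
    using e_approx_32 by (intro power_mono) (auto simp: abs_if split: if_splits)
  \<comment> \<open>The splits 3.262 = 3 + 4 * 0.0655 and 3.05 = 3 + 0.05 confine the quadratic
    bound for \<open>exp\<close> to small arguments.\<close>
  have "exp (0.0655::real) \<le> 1 + 0.0655 + 0.0655\<^sup>2"
    by (rule exp_bound) auto
  then have "exp (0.0655::real) ^ 4 \<le> (1 + 0.0655 + 0.0655\<^sup>2) ^ 4"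
    by (intro power_mono) auto
  with e have "exp (1::real) ^ 3 * exp (0.0655::real) ^ 4
      \<le> (5837465778 / 2147483648) ^ 3 * (1 + 0.0655 + 0.0655\<^sup>2) ^ 4"
    by (intro mult_mono) auto
  moreover have "exp (3.262::real) = exp (1::real) ^ 3 * exp (0.0655::real) ^ 4"
    by (simp flip: exp_of_nat_mult exp_add)
  ultimately show "exp (3.262::real) < 26.39" by (simp add: power2_eq_square eval_nat_numeral)
  have "exp (0.05::real) \<le> 1 + 0.05 + 0.05\<^sup>2"
    by (rule exp_bound) auto
  with e have "exp (1::real) ^ 3 * exp (0.05::real)
      \<le> (5837465778 / 2147483648) ^ 3 * (1 + 0.05 + 0.05\<^sup>2)"
    by (intro mult_mono) auto
  moreover have "exp (3.05::real) = exp (1::real) ^ 3 * exp (0.05::real)"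
    by (simp flip: exp_of_nat_mult exp_add)
  ultimately show "exp (3.05::real) < 21.2" by (simp add: power2_eq_square eval_nat_numeral)
qed

text \<open>These bound the exponent in \<open>amplitude_bound\<close>. The range
  \<open>r \<le> 0.58\<close> contains all cases with \<open>c \<ge> 1\<close>, where the sharper
  constant is used.\<close>

lemma amplitude_exponent_bounds:
  fixes r :: real
  assumes r: "0 \<le> r"
  shows "r \<le> 1 \<Longrightarrow> 5 * pi / 4 * r - 3 / 2 * r\<^sup>2 + 5 / (3 * (1 + r\<^sup>2)) \<le> 3.262"
    and "r \<le> 0.58 \<Longrightarrow> 5 * pi / 4 * r - 3 / 2 * r\<^sup>2 + 5 / (3 * (1 + r\<^sup>2)) \<le> 3.05"
proof -
  have "5 * pi / 4 \<le> 3.927" using pi_approx by simp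
  then have pr: "5 * pi / 4 * r \<le> 3.927 * r" using r by (rule mult_right_mono)
  have r1: "1 + r\<^sup>2 > 0" by (simp add: add_pos_nonneg)
  have *: "5 * pi / 4 * r - 3 / 2 * r\<^sup>2 + 5 / (3 * (1 + r\<^sup>2)) \<le> K"
    if "5 \<le> (K - 3.927 * r + 3 / 2 * r\<^sup>2) * (3 * (1 + r\<^sup>2))" for K
  proof -
    have "5 / (3 * (1 + r\<^sup>2)) \<le> K - 3.927 * r + 3 / 2 * r\<^sup>2"
      using that r1 by (subst pos_divide_le_eq) auto
    then show ?thesis using pr by linarith
  qed
  show "5 * pi / 4 * r - 3 / 2 * r\<^sup>2 + 5 / (3 * (1 + r\<^sup>2)) \<le> 3.262" if "r \<le> 1"
  proof (rule *)
    \<comment> \<open>Expansion at the right end of the range writes the quartic in visibly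
      nonnegative terms; the second bound does the same at 0.58.\<close>
    define s where "s = 1 - r"
    have s: "s \<ge> 0" and rs: "r = 1 - s" using that by (auto simp: s_def)
    have "(3.262 - 3.927 * r + 3 / 2 * r\<^sup>2) * (3 * (1 + r\<^sup>2)) - 5
        = 0.01 + 0.552 * s + s\<^sup>2 * (4.5 * (s - 0.691)\<^sup>2 + 3.7943355)"
      unfolding rs by (simp add: field_simps power2_eq_square)
    moreover have "\<dots> \<ge> 0" using s by (intro add_nonneg_nonneg mult_nonneg_nonneg) auto
    ultimately show "5 \<le> (3.262 - 3.927 * r + 3 / 2 * r\<^sup>2) * (3 * (1 + r\<^sup>2))" by linarith
  qed
  show "5 * pi / 4 * r - 3 / 2 * r\<^sup>2 + 5 / (3 * (1 + r\<^sup>2)) \<le> 3.05" if "r \<le> 0.58"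
  proof (rule *)
    define s where "s = 0.58 - r"
    have s: "s \<ge> 0" and rs: "r = 0.58 - s" using that by (auto simp: s_def)
    have "(3.05 - 3.927 * r + 3 / 2 * r\<^sup>2) * (3 * (1 + r\<^sup>2)) - 5
        = 0.119507848 + 4.3243692 * s + 2.23386 * s\<^sup>2 + 1.341 * s ^ 3 + 4.5 * s ^ 4"
      unfolding rs by (simp add: field_simps power2_eq_square eval_nat_numeral)
    moreover have "\<dots> \<ge> 0" using s by (intro add_nonneg_nonneg mult_nonneg_nonneg) auto
    ultimately show "5 \<le> (3.05 - 3.927 * r + 3 / 2 * r\<^sup>2) * (3 * (1 + r\<^sup>2))" by linarith
  qed
qed

lemma amplitude_bound:
  fixes r :: real
  assumes r: "0 \<le> r" "r \<le> 1"
  shows "sqrt (1 - r\<^sup>2) / (1 + r\<^sup>2) * exp (5 * pi / 4 * r)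
    \<le> sqrt 3 / 5 * exp (5 * pi / 4 * r - 3 / 2 * r\<^sup>2 + 5 / (3 * (1 + r\<^sup>2)))"
proof -
  \<comment> \<open>Both factors are estimated by \<open>x \<le> exp (x - 1)\<close>, scaled so that equality holds at \<open>r\<^sup>2 = 2/3\<close>.\<close>
  have le: "x \<le> exp (x - 1)" for x :: real
    using exp_ge_add_one_self[of "x - 1"] by simp
  have r2: "r\<^sup>2 \<le> 1" using r by (simp add: power_le_one)
  have "3 * (1 - r\<^sup>2) \<le> exp (3 * (1 - r\<^sup>2) - 1)" by (rule le)
  also have "\<dots> = (exp (1 - 3 / 2 * r\<^sup>2))\<^sup>2"
    by (simp add: algebra_simps flip: exp_double)
  finally have "1 - r\<^sup>2 \<le> (exp (1 - 3 / 2 * r\<^sup>2))\<^sup>2 / 3" by simp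
  then have "sqrt (1 - r\<^sup>2) \<le> sqrt ((exp (1 - 3 / 2 * r\<^sup>2))\<^sup>2 / 3)" by (rule real_sqrt_le_mono)
  also have "\<dots> = sqrt 3 / 3 * exp (1 - 3 / 2 * r\<^sup>2)"
    by (simp add: real_sqrt_divide field_simps)
  finally have 1: "sqrt (1 - r\<^sup>2) \<le> sqrt 3 / 3 * exp (1 - 3 / 2 * r\<^sup>2)" .
  have "1 / (1 + r\<^sup>2) = 3 / 5 * (5 / (3 * (1 + r\<^sup>2)))"
    by (simp add: divide_simps)
  also have "\<dots> \<le> 3 / 5 * exp (5 / (3 * (1 + r\<^sup>2)) - 1)"
    by (intro mult_left_mono le) auto
  finally have 2: "1 / (1 + r\<^sup>2) \<le> 3 / 5 * exp (5 / (3 * (1 + r\<^sup>2)) - 1)" .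
  have "sqrt (1 - r\<^sup>2) * (1 / (1 + r\<^sup>2)) * exp (5 * pi / 4 * r)
      \<le> (sqrt 3 / 3 * exp (1 - 3 / 2 * r\<^sup>2)) * (3 / 5 * exp (5 / (3 * (1 + r\<^sup>2)) - 1)) * exp (5 * pi / 4 * r)"
    using 1 2 r2 by (intro mult_mono) auto
  also have "\<dots> = sqrt 3 / 5 * exp ((1 - 3 / 2 * r\<^sup>2) + (5 / (3 * (1 + r\<^sup>2)) - 1) + 5 * pi / 4 * r)"
    unfolding exp_add by simp
  finally show ?thesis by (simp add: algebra_simps)
qed

text \<open>\<open>G\<close> is the majorant of \<open>\<beta> * T\<close> that the tail yields in
  \<open>wave_branch\<close>, and both constants are chosen for the comparison with
  \<open>6 * pi\<close> there. The ratio \<open>r = p / q\<close> turns the estimate into one in a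
  single variable.\<close>

lemma speed_bound:
  fixes c p q :: real
  assumes c: "c > 0" and p: "p > 0" and q: "q > 0"
    and pq: "p\<^sup>2 + q\<^sup>2 = 1" and c2: "c\<^sup>2 = 2 - 4 * p\<^sup>2"
  defines "G \<equiv> c * (q - p + sqrt 2 * q * exp (p * (5 * pi / (4 * q))))"
  shows "G < 18.7" and "c \<ge> 1 \<Longrightarrow> G < 16.4"
proof -
  define r where "r = p / q"
  define S where "S = sqrt (1 - r\<^sup>2) / (1 + r\<^sup>2)"
  define E where "E = exp (5 * pi / 4 * r)"
  have pr: "p = r * q" using q by (simp add: r_def)
  have "c\<^sup>2 > 0" using c by simp
  then have "p\<^sup>2 < q\<^sup>2" using c2 pq by linarith
  then have "p < q" using p q by (simp add: power2_less_imp_less)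
  then have r: "0 < r" "r < 1" using p q by (auto simp: r_def)
  have r2: "r\<^sup>2 < 1" "r\<^sup>2 \<ge> 0" using r by (auto simp: power_less_one_iff)
  have q2: "(1 + r\<^sup>2) * q\<^sup>2 = 1" using pq unfolding pr by (simp add: algebra_simps power_mult_distrib)
  have r1: "1 + r\<^sup>2 > 0" using r2 by linarith
  have q2': "q\<^sup>2 = 1 / (1 + r\<^sup>2)" using q2 r1 by (simp add: field_simps)
  have c2': "c\<^sup>2 * (1 + r\<^sup>2) = 2 * (1 - r\<^sup>2)"
  proof -
    have "c\<^sup>2 = 2 - 4 * r\<^sup>2 * q\<^sup>2" using c2 by (simp add: pr power_mult_distrib)
    then have "c\<^sup>2 * (1 + r\<^sup>2) = (2 - 4 * r\<^sup>2 * q\<^sup>2) * (1 + r\<^sup>2)"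
      by (rule arg_cong)
    also have "\<dots> = 2 * (1 + r\<^sup>2) - 4 * r\<^sup>2 * ((1 + r\<^sup>2) * q\<^sup>2)"
      by (simp add: algebra_simps)
    finally have "c\<^sup>2 * (1 + r\<^sup>2) = 2 * (1 + r\<^sup>2) - 4 * r\<^sup>2 * ((1 + r\<^sup>2) * q\<^sup>2)" .
    then show ?thesis using q2 by simp
  qed
  have S0: "S \<ge> 0" using r2 by (simp add: S_def)
  have "(c * q)\<^sup>2 = c\<^sup>2 * q\<^sup>2" by (simp add: power_mult_distrib)
  also have "\<dots> = 2 * (1 - r\<^sup>2) / (1 + r\<^sup>2)\<^sup>2"
  proof -
    have "c\<^sup>2 = 2 * (1 - r\<^sup>2) / (1 + r\<^sup>2)" using c2' r1 by (simp add: eq_divide_eq)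
    then show ?thesis unfolding q2' by (simp add: power2_eq_square)
  qed
  also have "\<dots> = (sqrt 2 * S)\<^sup>2"
    using r2 by (simp add: S_def power_mult_distrib power_divide)
  finally have cq: "c * q = sqrt 2 * S"
    using c q S0 by (subst (asm) power2_eq_iff_nonneg) auto
  \<comment> \<open>The first summand is small and bounded crudely; the second carries the
    exponential and goes through \<open>amplitude_bound\<close>.\<close>
  have GE: "G = sqrt 2 * S * (1 - r) + 2 * (S * E)"
  proof -
    have "p * (5 * pi / (4 * q)) = 5 * pi / 4 * r" using q by (simp add: pr field_simps)
    then have "G = (c * q) * (1 - r) + sqrt 2 * (c * q) * E"
      by (simp add: G_def E_def pr algebra_simps)
    then show ?thesis unfolding cq by simp
  qed
  have s2: "sqrt 2 < (1.415::real)" by (rule real_less_lsqrt) (auto simp: power2_eq_square)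
  have s3: "sqrt 3 < (1.7321::real)" by (rule real_less_lsqrt) (auto simp: power2_eq_square)
  have SE: "S * E \<le> sqrt 3 / 5 * exp (5 * pi / 4 * r - 3 / 2 * r\<^sup>2 + 5 / (3 * (1 + r\<^sup>2)))"
    unfolding S_def E_def using r by (intro amplitude_bound) auto
  have SE': "2 * (S * E) \<le> 0.69284 * K"
    if "5 * pi / 4 * r - 3 / 2 * r\<^sup>2 + 5 / (3 * (1 + r\<^sup>2)) \<le> k" "exp k < K" for k K
  proof -
    have "S * E \<le> sqrt 3 / 5 * K"
      by (rule order_trans[OF SE]) (use that in \<open>auto intro!: mult_left_mono intro: order_trans[OF _ less_imp_le]\<close>)
    also have "\<dots> \<le> 1.7321 / 5 * K"
      using s3 less_trans[OF exp_gt_zero that(2)] by (intro mult_right_mono) auto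
    finally show ?thesis by simp
  qed
  have small: "G < 16.4" if "r \<le> 0.58"
  proof -
    have "S \<le> 1 / 1"
      unfolding S_def using r2 by (intro frac_le) auto
    then have "sqrt 2 * S * (1 - r) \<le> 1.415 * 1 * 1"
      using s2 r S0 by (intro mult_mono) auto
    moreover have "2 * (S * E) \<le> 0.69284 * 21.2"
      using that r by (intro SE'[where k = "3.05"] amplitude_exponent_bounds exp_upper_bounds) auto
    ultimately show ?thesis unfolding GE by simp
  qed
  show "G < 18.7"
  proof (cases "r \<le> 0.58")
    case False
    then have r58: "r \<ge> 0.58" by simp
    then have "r\<^sup>2 \<ge> 0.58\<^sup>2" by (intro power_mono) auto
    then have r2': "r\<^sup>2 \<ge> 0.3364" by (simp add: power2_eq_square)
    \<comment> \<open>Here 0.82 exceeds sqrt (1 - 0.3364), 1.33 is below 1 + 0.3364, and 0.42 = 1 -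
      0.58.\<close>
    have "sqrt (1 - r\<^sup>2) \<le> 0.82"
      using r2' by (intro real_le_lsqrt) (auto simp: power2_eq_square)
    then have "S \<le> 0.82 / 1.33"
      unfolding S_def using r2 r2' by (intro frac_le) auto
    then have "sqrt 2 * S * (1 - r) \<le> 1.415 * (0.82 / 1.33) * 0.42"
      using s2 r r58 S0 by (intro mult_mono) auto
    moreover have "2 * (S * E) \<le> 0.69284 * 26.39"
      using r by (intro SE'[where k = "3.262"] amplitude_exponent_bounds exp_upper_bounds) auto
    ultimately show ?thesis unfolding GE by simp
  qed (use small in auto)
  show "G < 16.4" if "c \<ge> 1"
  proof (rule small)
    have "c\<^sup>2 \<ge> 1" using that by simp
    then have "1 * (1 + r\<^sup>2) \<le> c\<^sup>2 * (1 + r\<^sup>2)" using r1 by (intro mult_right_mono) auto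
    \<comment> \<open>The inequality gives r^2 \<le> 1/3, and 0.58 lies just above sqrt
      (1/3).\<close>
    then have "r\<^sup>2 \<le> 0.58\<^sup>2" unfolding c2' by (simp add: power2_eq_square)
    then show "r \<le> 0.58" using r by (simp add: power2_le_iff_abs_le)
  qed
qed


section \<open>Arctangent phase relations\<close>

text \<open>The derivative at s > 0 is 1 / (1 + (\<alpha> s)^2) - 1 / (1 + (\<beta> s)^2) > 0.
  Injectivity is what lets the branch number determine the slope.\<close>

lemma arctan_scaled_difference_strict_mono:
  fixes \<alpha> \<beta> v w :: real
  assumes "0 < \<alpha>" "\<alpha> < \<beta>" "0 \<le> v" "v < w"
  shows "arctan (\<alpha> * v) / \<alpha> - arctan (\<beta> * v) / \<beta> < arctan (\<alpha> * w) / \<alpha> - arctan (\<beta> * w) / \<beta>"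
proof -
  define D where "D = (\<lambda>s. arctan (\<alpha> * s) / \<alpha> - arctan (\<beta> * s) / \<beta>)"
  have D': "(D has_real_derivative 1 / (1 + (\<alpha> * s)\<^sup>2) - 1 / (1 + (\<beta> * s)\<^sup>2)) (at s)" for s
  proof -
    have "((\<lambda>s. arctan (k * s) / k) has_real_derivative 1 / (1 + (k * s)\<^sup>2)) (at s)" if "k > 0" for k
      using that by (auto intro!: derivative_eq_intros simp: inverse_eq_divide)
    then show ?thesis unfolding D_def using assms by (intro DERIV_diff) auto
  qed
  have "D v < D w"
  proof (rule DERIV_pos_imp_increasing_open[where f = D])
    fix s assume s: "v < s" "s < w"
    then have "(\<alpha> * s)\<^sup>2 < (\<beta> * s)\<^sup>2"
      using assms by (intro power_strict_mono mult_strict_right_mono) auto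
    then have "1 / (1 + (\<beta> * s)\<^sup>2) < 1 / (1 + (\<alpha> * s)\<^sup>2)"
      by (intro divide_strict_left_mono) (auto simp: add_pos_nonneg)
    then show "\<exists>y. (D has_real_derivative y) (at s) \<and> 0 < y"
      using D'[of s] by (metis diff_gt_0_iff_gt)
  next
    show "continuous_on {v..w} D"
      using D' by (intro DERIV_atLeastAtMost_imp_continuous_on) blast
  qed (use assms in simp)
  then show ?thesis by (simp add: D_def)
qed

lemma sin_eq_mult_cos_imp_arctan:
  fixes \<phi> x :: real
  assumes "sin \<phi> = x * cos \<phi>"
  obtains k :: int where "\<phi> = arctan x + of_int k * pi"
proof -
  have "sin (\<phi> - arctan x) = 0"
    using assms by (simp add: sin_diff sin_arctan cos_arctan)
  then obtain k :: int where "\<phi> - arctan x = of_int k * pi"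
    by (auto simp: sin_zero_iff_int2)
  then show ?thesis by (intro that[of k]) simp
qed

section \<open>Explicit profile and phase analysis of a single wave\<close>

text \<open>The first branch solves for z from the combinations z'' + \<beta>^2 (z + 1) and z'' +
  \<alpha>^2 (z + 1), each a constant plus one cosine; the second is the damped tail. With
  frequencies and phases fixed, only \<open>T\<close> and \<open>v\<close> vary between
  waves.\<close>

definition wave_profile ::
  "real \<Rightarrow> real \<Rightarrow> real \<Rightarrow> real \<Rightarrow> real \<Rightarrow> real \<Rightarrow> real \<Rightarrow> real \<Rightarrow> real \<Rightarrow> real \<Rightarrow> real" where
  "wave_profile \<alpha> \<beta> p q R \<delta> \<epsilon> T v t =
    (if t \<le> T then
       (1 / \<alpha>\<^sup>2 - R * (cos (\<alpha> * T + \<delta>) + \<alpha> * v * sin (\<alpha> * T + \<delta>)) / \<alpha>\<^sup>2 * cos (\<alpha> * t)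
        - (1 / \<beta>\<^sup>2 - R * (cos (\<beta> * T + \<epsilon>) + \<beta> * v * sin (\<beta> * T + \<epsilon>)) / \<beta>\<^sup>2 * cos (\<beta> * t)))
       / (\<beta>\<^sup>2 - \<alpha>\<^sup>2) - 1
     else exp (- p * (t - T)) * (- cos (q * (t - T)) + (v - p) / q * sin (q * (t - T))))"

text \<open>A one-troughed even wave, seen from its half \<open>t \<ge> 0\<close>: the trough is \<open>[0, T)\<close>, and
  \<open>p\<close>, \<open>q\<close> are the decay rate and the frequency of the tail.\<close>

locale even_wave =
  fixes c \<xi> p q T :: real and z z1 z2 z3 z4 :: "real \<Rightarrow> real"
  assumes derivs: "\<And>t. (z has_real_derivative z1 t) (at t)" "\<And>t. (z1 has_real_derivative z2 t) (at t)"
      "\<And>t. (z2 has_real_derivative z3 t) (at t)" "\<And>t. (z3 has_real_derivative z4 t) (at t)"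
    and inner_ode: "\<And>t. 0 \<le> t \<Longrightarrow> t \<le> T \<Longrightarrow> z4 t + c\<^sup>2 * z2 t + \<xi> * (z t + 1) = 1"
    and outer_ode: "\<And>t. T \<le> t \<Longrightarrow> z4 t + c\<^sup>2 * z2 t + z t = 0"
    and even: "\<And>t. z (- t) = z t"
    and decay: "(z1 \<longlongrightarrow> 0) at_top"
    and T_pos: "T > 0"
    and z_T: "z T = - 1"
    and trough: "\<And>t. 0 \<le> t \<Longrightarrow> t < T \<Longrightarrow> z t < - 1"
    and above: "\<And>t. T < t \<Longrightarrow> z t > - 1"
    and c_pos: "c > 0" and p_pos: "p > 0" and q_pos: "q > 0"
    and pq: "p\<^sup>2 + q\<^sup>2 = 1" and c2: "c\<^sup>2 = 2 - 4 * p\<^sup>2"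

lemma deriv_reflection:
  fixes f f1 :: "real \<Rightarrow> real"
  assumes "\<And>t. (f has_real_derivative f1 t) (at t)" "\<And>t. f (- t) = s * f t"
  shows "f1 (- t) = - s * f1 t"
proof -
  have "((\<lambda>t. f (- t)) has_real_derivative f1 (- t) * (- 1)) (at t)"
    by (rule DERIV_chain2[OF assms(1)]) (auto intro!: derivative_eq_intros)
  moreover have "((\<lambda>t. f (- t)) has_real_derivative s * f1 t) (at t)"
    unfolding assms(2) by (auto intro!: derivative_eq_intros assms(1))
  ultimately show ?thesis by (auto dest: DERIV_unique)
qed

context even_wave
begin

lemma derivs_symmetry: "z1 (- t) = - z1 t" "z2 (- t) = z2 t" "z3 (- t) = - z3 t"
proof -
  show 1: "z1 (- t) = - z1 t" for t
    using deriv_reflection[OF derivs(1), of 1 t] even by simp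
  show 2: "z2 (- t) = z2 t" for t
    using deriv_reflection[OF derivs(2), of "- 1" t] 1 by simp
  show "z3 (- t) = - z3 t"
    using deriv_reflection[OF derivs(3), of 1 t] 2 by simp
qed

lemma nonpos: "\<bar>t\<bar> \<le> T \<Longrightarrow> z t + 1 \<le> 0"
  using trough[of "\<bar>t\<bar>"] z_T even[of t] by (cases "\<bar>t\<bar> = T"; cases "t \<ge> 0") auto

lemma outer_reduced:
  assumes "T \<le> t"
  shows "z2 t + 2 * p * z1 t + z t = 0" "z3 t + 2 * p * z2 t + z1 t = 0"
  using decaying_solution_factor[OF derivs _ p_pos q_pos pq decay, of t] outer_ode assms c2 by auto

lemma outer_profile:
  assumes "T \<le> t"
  shows "z t = exp (- p * (t - T)) * (- cos (q * (t - T)) + (z1 T - p) / q * sin (q * (t - T)))"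
proof -
  have "z t = exp (- p * (t - T)) * (z T * cos (q * (t - T)) + (z1 T - (- p) * z T) / q * sin (q * (t - T)))"
  proof (rule damped_oscillator(1)[where b = t, OF derivs(1,2)])
    show "z2 s = 2 * - p * z1 s - ((- p)\<^sup>2 + q\<^sup>2) * z s" if "T \<le> s" for s
      using outer_reduced(1)[OF that] pq by (simp add: algebra_simps)
  qed (use assms q_pos in auto)
  then show ?thesis by (simp add: z_T)
qed

lemma slope_nonneg: "z1 T \<ge> 0"
proof (rule ccontr)
  assume "\<not> z1 T \<ge> 0"
  then obtain d where "d > 0" "\<And>h. 0 < h \<Longrightarrow> h < d \<Longrightarrow> z (T + h) < z T"
    using DERIV_neg_dec_right[OF derivs(1)[of T]] by auto
  from this(2)[of "d / 2"] this(1) above[of "T + d / 2"] show False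
    by (simp add: z_T)
qed

text \<open>\<open>x\<close> is one inner frequency and \<open>y\<close> the other. Forming z'' +
  y^2 (z + 1) - 1/x^2 removes the \<open>y\<close> mode, and evenness leaves a pure cosine of
  frequency \<open>x\<close>. The numbers \<open>R\<close> and \<open>\<delta>\<close> are modulus
  and argument of 1 - x^2 + 2 i p x, the value at i x of the tail polynomial s^2 + 2 p s +
  1.\<close>

lemma mode:
  assumes x: "x > 0" and xy: "x\<^sup>2 + y\<^sup>2 = c\<^sup>2" "x\<^sup>2 * y\<^sup>2 = \<xi>"
    and R: "R > 0" "R * cos \<delta> = 1 - x\<^sup>2" "R * sin \<delta> = 2 * p * x"
  shows "sin (x * T + \<delta>) = x * z1 T * cos (x * T + \<delta>)"
    and "0 \<le> t \<Longrightarrow> t \<le> T \<Longrightarrow> z2 t + y\<^sup>2 * (z t + 1) =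
      1 / x\<^sup>2 - R * (cos (x * T + \<delta>) + x * z1 T * sin (x * T + \<delta>)) / x\<^sup>2 * cos (x * t)"
proof -
  define v where "v = z1 T"
  define W where "W = (\<lambda>t. z2 t + y\<^sup>2 * (z t + 1) - 1 / x\<^sup>2)"
  define W1 where "W1 = (\<lambda>t. z3 t + y\<^sup>2 * z1 t)"
  define W2 where "W2 = (\<lambda>t. z4 t + y\<^sup>2 * z2 t)"
  have dW: "(W has_real_derivative W1 t) (at t)" "(W1 has_real_derivative W2 t) (at t)" for t
    unfolding W_def W1_def W2_def by (auto intro!: derivative_eq_intros derivs)
  have ode: "W2 t = 2 * 0 * W1 t - (0\<^sup>2 + x\<^sup>2) * W t" if "0 \<le> t" "t \<le> T" for t
  proof -
    have "x\<^sup>2 * W t = x\<^sup>2 * z2 t + x\<^sup>2 * y\<^sup>2 * (z t + 1) - 1"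
      using x by (simp add: W_def algebra_simps)
    then show ?thesis
      using inner_ode[OF that] by (simp add: W2_def xy(2) algebra_simps flip: xy(1))
  qed
  have W10: "W1 0 = 0" using derivs_symmetry(1,3)[of 0] by (simp add: W1_def)
  have W: "W t = W 0 * cos (x * t)" and W1: "W1 t / x = - W 0 * sin (x * t)"
    if "0 \<le> t" "t \<le> T" for t
    using damped_oscillator[OF dW ode _ that] x W10 by simp_all
  \<comment> \<open>The factored tail equation expresses all matching data at \<open>T\<close>
    through the slope \<open>v\<close>.\<close>
  have z2T: "z2 T = 1 - 2 * p * v" and z3T: "z3 T = - 2 * p * z2 T - v"
    using outer_reduced[of T] by (simp_all add: z_T v_def)
  have "x\<^sup>2 * W T = x\<^sup>2 * (1 - 2 * p * v) - 1"
    using x by (simp add: W_def z_T z2T algebra_simps)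
  also have "\<dots> = - (R * cos \<delta>) - x * v * (R * sin \<delta>)"
    unfolding R by (simp add: algebra_simps power2_eq_square)
  finally have c: "x\<^sup>2 * W 0 * cos (x * T) = - (R * cos \<delta>) - x * v * (R * sin \<delta>)"
    using W[of T] T_pos by simp
  have "W1 T = - 2 * p + (4 * p\<^sup>2 - 1 + y\<^sup>2) * v"
    by (simp add: W1_def z3T z2T algebra_simps power2_eq_square flip: v_def)
  also have "4 * p\<^sup>2 - 1 + y\<^sup>2 = 1 - x\<^sup>2" using c2 xy by simp
  finally have W1T: "W1 T = - 2 * p + (1 - x\<^sup>2) * v" .
  have "x\<^sup>2 * W 0 * sin (x * T) = - x\<^sup>2 * (W1 T / x)"
    using W1[of T] T_pos by simp
  also have "\<dots> = - x * W1 T" using x by (simp add: power2_eq_square)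
  also have "\<dots> = R * sin \<delta> - x * v * (R * cos \<delta>)"
    unfolding R W1T by (simp add: algebra_simps)
  finally have s: "x\<^sup>2 * W 0 * sin (x * T) = R * sin \<delta> - x * v * (R * cos \<delta>)" .
  let ?C = "cos (x * T)" and ?S = "sin (x * T)"
  \<comment> \<open>Cross-multiplying the two matching equations eliminates \<open>W 0\<close> and
    leaves the phase relation; combining them with weights \<open>?C\<close> and \<open>?S\<close>
    afterwards recovers \<open>W 0\<close>.\<close>
  have "(x\<^sup>2 * W 0 * ?C) * ?S = (x\<^sup>2 * W 0 * ?S) * ?C" by simp
  then have "R * (sin (x * T + \<delta>) - x * v * cos (x * T + \<delta>)) = 0"
    unfolding c s by (simp add: sin_add cos_add algebra_simps)
  then show "sin (x * T + \<delta>) = x * z1 T * cos (x * T + \<delta>)"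
    using R(1) by (simp add: v_def)
  have "x\<^sup>2 * W 0 = x\<^sup>2 * W 0 * (?S\<^sup>2 + ?C\<^sup>2)" by simp
  also have "\<dots> = (x\<^sup>2 * W 0 * ?C) * ?C + (x\<^sup>2 * W 0 * ?S) * ?S"
    by (simp only: power2_eq_square) (simp only: algebra_simps)
  also have "\<dots> = - R * (cos (x * T + \<delta>) + x * v * sin (x * T + \<delta>))"
    unfolding c s by (simp add: sin_add cos_add algebra_simps)
  finally have "W 0 = - R * (cos (x * T + \<delta>) + x * v * sin (x * T + \<delta>)) / x\<^sup>2"
    using x by (simp add: field_simps)
  then show "z2 t + y\<^sup>2 * (z t + 1) =
      1 / x\<^sup>2 - R * (cos (x * T + \<delta>) + x * z1 T * sin (x * T + \<delta>)) / x\<^sup>2 * cos (x * t)"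
    if "0 \<le> t" "t \<le> T"
    using W[OF that] by (simp add: W_def v_def)
qed

text \<open>Positive forcing would make the sum of z + 1 at the two ends of the window positive, but
  both ends lie in the closed trough.\<close>

lemma no_positive_forcing:
  assumes w: "w > 0" and s: "\<bar>s\<bar> + pi / (2 * w) \<le> T"
    and pos: "\<And>t. \<bar>t - s\<bar> < pi / (2 * w) \<Longrightarrow> z2 t + w\<^sup>2 * (z t + 1) > 0"
  shows False
proof -
  have "(\<lambda>t. z t + 1) (s - pi / (2 * w)) + (\<lambda>t. z t + 1) (s + pi / (2 * w)) > 0"
    by (rule forced_oscillator_positive_half_period[where ?u1.0 = z1 and ?u2.0 = z2])
      (use w pos in \<open>auto intro!: derivative_eq_intros derivs\<close>)
  moreover have "\<bar>s - pi / (2 * w)\<bar> \<le> T" "\<bar>s + pi / (2 * w)\<bar> \<le> T"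
    using s divide_pos_pos[of pi "2 * w"] w pi_gt_zero by linarith+
  ultimately show False
    using nonpos[of "s - pi / (2 * w)"] nonpos[of "s + pi / (2 * w)"] by simp
qed

text \<open>The phase relation fixes \<open>\<theta>\<close> only modulo \<open>pi\<close>; the sign
  of z + 1 in the trough confines it to (0, pi/2). The test windows are half periods of the higher
  frequency \<open>\<beta>\<close>, shorter than those of cos (\<alpha> t).\<close>

lemma low_frequency_phase:
  assumes \<alpha>: "0 < \<alpha>" "\<alpha> < \<beta>" and ab: "\<alpha>\<^sup>2 + \<beta>\<^sup>2 = c\<^sup>2" "\<alpha>\<^sup>2 * \<beta>\<^sup>2 = \<xi>"
    and R: "R > 0" "R * cos \<delta> = 1 - \<alpha>\<^sup>2" "R * sin \<delta> = 2 * p * \<alpha>"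
    and \<delta>: "0 < \<delta>" "\<delta> < pi / 2"
  shows "\<alpha> * T + \<delta> = arctan (\<alpha> * z1 T)"
proof -
  define \<theta> where "\<theta> = \<alpha> * T + \<delta>"
  define a where "a = - R * (cos \<theta> + \<alpha> * z1 T * sin \<theta>) / \<alpha>\<^sup>2"
  have \<theta>_pos: "\<theta> > 0" using \<alpha> \<delta> T_pos by (simp add: \<theta>_def add_pos_pos)
  have sin_\<theta>: "sin \<theta> = \<alpha> * z1 T * cos \<theta>"
    unfolding \<theta>_def by (rule mode[OF \<alpha>(1) ab R])
  have forcing: "z2 t + \<beta>\<^sup>2 * (z t + 1) = 1 / \<alpha>\<^sup>2 + a * cos (\<alpha> * t)" if "\<bar>t\<bar> \<le> T" for t
  proof -
    have "z2 \<bar>t\<bar> + \<beta>\<^sup>2 * (z \<bar>t\<bar> + 1) = 1 / \<alpha>\<^sup>2 + a * cos (\<alpha> * \<bar>t\<bar>)"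
      using mode(2)[OF \<alpha>(1) ab R, of "\<bar>t\<bar>"] that by (simp add: a_def \<theta>_def)
    then show ?thesis
      using even[of t] derivs_symmetry(2)[of t] by (cases "t \<ge> 0") auto
  qed
  have v: "\<alpha> * z1 T \<ge> 0" using \<alpha> slope_nonneg by simp
  have a_cos: "a = - R * (1 + (\<alpha> * z1 T)\<^sup>2) / \<alpha>\<^sup>2 * cos \<theta>"
    unfolding a_def sin_\<theta> by (simp add: algebra_simps power2_eq_square)
  have \<beta>: "\<beta> > 0" using \<alpha> by simp
  have half: "pi / (2 * \<beta>) < pi / (2 * \<alpha>)"
    using \<alpha> by (intro divide_strict_left_mono) auto
  have "0 < cos \<theta> \<and> \<theta> < pi / 2"
  \<comment> \<open>If no window fits into the trough, then \<alpha> T < pi/2 bounds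
    \<open>\<theta>\<close> directly.\<close>
  proof (cases "pi / (2 * \<beta>) \<le> T")
    case True
    \<comment> \<open>Otherwise the forcing is positive on the window centred at 0, where cos
      (\<alpha> t) > 0.\<close>
    have "a < 0"
    proof (rule ccontr)
      assume "\<not> a < 0"
      have "z2 t + \<beta>\<^sup>2 * (z t + 1) > 0" if t: "\<bar>t - 0\<bar> < pi / (2 * \<beta>)" for t
      proof -
        have "\<bar>\<alpha> * t\<bar> < pi / 2"
        proof -
          have "\<bar>t\<bar> < pi / (2 * \<alpha>)" using t half by simp
          then show ?thesis using \<alpha> by (simp add: abs_mult field_simps)
        qed
        then have "cos (\<alpha> * t) > 0" by (intro cos_gt_zero_pi) (auto simp: abs_less_iff)
        then have "a * cos (\<alpha> * t) \<ge> 0" using \<open>\<not> a < 0\<close> by simp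
        then show ?thesis
          using forcing[of t] t True \<alpha> by (simp add: add_pos_nonneg)
      qed
      then show False
        using no_positive_forcing[OF \<beta>, of 0] True by simp
    qed
    moreover have "R * (1 + (\<alpha> * z1 T)\<^sup>2) / \<alpha>\<^sup>2 > 0"
      using R \<alpha> by (intro divide_pos_pos mult_pos_pos) (auto simp: add_pos_nonneg)
    moreover have "a = - (R * (1 + (\<alpha> * z1 T)\<^sup>2) / \<alpha>\<^sup>2 * cos \<theta>)"
      by (simp add: a_cos)
    ultimately have cos: "cos \<theta> > 0"
      by (metis neg_less_0_iff_less zero_less_mult_pos)
    \<comment> \<open>With \<open>a < 0\<close> the forcing is positive where cos (\<alpha> t) < 0,
      so a longer trough would contain a forbidden window centred at
      \<open>pi / \<alpha>\<close>.\<close>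
    have "\<alpha> * T < 3 * pi / 2"
    proof (rule ccontr)
      assume "\<not> \<alpha> * T < 3 * pi / 2"
      then have T: "3 * pi / (2 * \<alpha>) \<le> T" using \<alpha> by (simp add: field_simps)
      have "z2 t + \<beta>\<^sup>2 * (z t + 1) > 0" if t: "\<bar>t - pi / \<alpha>\<bar> < pi / (2 * \<beta>)" for t
      proof -
        have "\<bar>t - pi / \<alpha>\<bar> < pi / (2 * \<alpha>)" using t half by simp
        then have "pi / \<alpha> - pi / (2 * \<alpha>) < t" "t < pi / \<alpha> + pi / (2 * \<alpha>)"
          by (auto simp: abs_less_iff)
        then have t': "pi / 2 < \<alpha> * t" "\<alpha> * t < 3 * pi / 2"
          using \<alpha> by (auto simp: field_simps)
        then have "cos (\<alpha> * t - pi) > 0" by (intro cos_gt_zero_pi) auto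
        then have "a * cos (\<alpha> * t) \<ge> 0" using \<open>a < 0\<close> by (simp add: mult_nonpos_nonpos)
        moreover have "\<bar>t\<bar> \<le> T"
        proof -
          have "t > 0" using t' \<alpha> by (smt (verit) pi_gt_zero zero_less_mult_iff divide_pos_pos)
          moreover have "t \<le> 3 * pi / (2 * \<alpha>)" using t' \<alpha> by (simp add: field_simps)
          ultimately show ?thesis using T by simp
        qed
        ultimately show ?thesis
          using forcing[of t] \<alpha> by (simp add: add_pos_nonneg)
      qed
      moreover have "\<bar>pi / \<alpha>\<bar> + pi / (2 * \<beta>) \<le> T"
      proof -
        have "pi / \<alpha> + pi / (2 * \<alpha>) = 3 * pi / (2 * \<alpha>)" using \<alpha> by (simp add: field_simps)
        then show ?thesis using half T \<alpha> by simp
      qed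
      ultimately show False using no_positive_forcing[OF \<beta>] by blast
    qed
    then have "\<theta> < 2 * pi" using \<delta> by (simp add: \<theta>_def)
    have "sin \<theta> \<ge> 0" unfolding sin_\<theta> using v cos by simp
    have "\<theta> < pi / 2"
    proof (rule ccontr)
      assume "\<not> \<theta> < pi / 2"
      show False
      proof (cases "\<theta> \<le> 3 * pi / 2")
        case True
        then have "cos (\<theta> - pi) \<ge> 0" using \<open>\<not> \<theta> < pi / 2\<close> by (intro cos_ge_zero) auto
        then show False using cos by simp
      next
        case False
        then show False using sin_lt_zero[of \<theta>] \<open>\<theta> < 2 * pi\<close> \<open>sin \<theta> \<ge> 0\<close> by simp
      qed
    qed
    with cos show ?thesis by simp
  next
    case False
    then have "T < pi / (2 * \<alpha>)" using half by simp
    then have "\<theta> < pi" using \<alpha> \<delta> by (simp add: \<theta>_def field_simps)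
    then have "sin \<theta> > 0" using \<theta>_pos by (simp add: sin_gt_zero)
    then have cos: "cos \<theta> > 0" unfolding sin_\<theta> using v by (simp add: zero_less_mult_iff)
    have "\<theta> < pi / 2"
    proof (rule ccontr)
      assume "\<not> \<theta> < pi / 2"
      then have "cos \<theta> \<le> cos (pi / 2)" using \<open>\<theta> < pi\<close> by (intro cos_monotone_0_pi_le) auto
      then show False using cos by simp
    qed
    with cos show ?thesis by simp
  qed
  then show ?thesis
    using \<theta>_pos sin_\<theta> unfolding \<theta>_def[symmetric]
    by (intro arctan_unique[symmetric]) (auto simp: tan_def)
qed

text \<open>At tail phase 5 pi / 4 sine and cosine both equal - sqrt 2 / 2, so staying above -1
  there is a linear upper bound on the slope. The form c (v - 2 p) suits the estimates T \<le> v - 2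
  p and \<beta> < c.\<close>

lemma slope_bound: "c * (z1 T - 2 * p) < c * (q - p + sqrt 2 * q * exp (p * (5 * pi / (4 * q))))"
proof -
  define s where "s = 5 * pi / (4 * q)"
  have qs: "q * s = pi + pi / 4" using q_pos by (simp add: s_def field_simps)
  have s: "s > 0" using q_pos by (simp add: s_def)
  have "- 1 < z (T + s)" using s by (intro above) simp
  also have "\<dots> = exp (- p * s) * (- cos (q * s) + (z1 T - p) / q * sin (q * s))"
    using outer_profile[of "T + s"] s by simp
  also have "\<dots> = exp (- p * s) * (sqrt 2 / 2 * (1 - (z1 T - p) / q))"
  proof -
    have ring: "- (- h) + A * (- h) = h * (1 - A)" for A h :: real by (simp add: algebra_simps)
    have cs: "cos (q * s) = - (sqrt 2 / 2)" "sin (q * s) = - (sqrt 2 / 2)"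
      unfolding qs cos_add sin_add by (simp_all add: cos_45 sin_45)
    show ?thesis unfolding cs ring ..
  qed
  finally have "exp (p * s) * (- 1) < exp (p * s) * (exp (- p * s) * (sqrt 2 / 2 * (1 - (z1 T - p) / q)))"
    by (rule mult_strict_left_mono) simp
  also have "\<dots> = sqrt 2 / 2 * (1 - (z1 T - p) / q)"
    by (simp flip: exp_add mult.assoc)
  finally have "sqrt 2 * (exp (p * s) * (- 1)) < sqrt 2 * (sqrt 2 / 2 * (1 - (z1 T - p) / q))"
    by (rule mult_strict_left_mono) simp
  also have "\<dots> = 1 - (z1 T - p) / q" by (simp flip: mult.assoc)
  finally have "(z1 T - p) / q < 1 + sqrt 2 * exp (p * s)" by simp
  then have "z1 T - p < (1 + sqrt 2 * exp (p * s)) * q"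
    using q_pos by (simp add: pos_divide_less_eq)
  then have "z1 T - 2 * p < q - p + sqrt 2 * q * exp (p * s)" by (simp add: algebra_simps)
  then show ?thesis using c_pos unfolding s_def by (rule mult_strict_left_mono)
qed

lemma wave_branch:
  assumes \<alpha>: "0 < \<alpha>" "\<alpha> < \<beta>" and ab: "\<alpha>\<^sup>2 + \<beta>\<^sup>2 = c\<^sup>2" "\<alpha>\<^sup>2 * \<beta>\<^sup>2 = \<xi>"
    and R: "0 < R" "R \<le> 1"
    and \<delta>: "R * cos \<delta> = 1 - \<alpha>\<^sup>2" "R * sin \<delta> = 2 * p * \<alpha>" "0 < \<delta>" "\<delta> < pi / 2"
    and \<epsilon>: "R * cos \<epsilon> = 1 - \<beta>\<^sup>2" "R * sin \<epsilon> = 2 * p * \<beta>" "0 < \<epsilon>" "\<epsilon> < pi"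
  obtains k :: nat where "k < 6" "\<alpha> * T + \<delta> = arctan (\<alpha> * z1 T)"
    "\<beta> * T + \<epsilon> = arctan (\<beta> * z1 T) + real k * pi"
proof -
  define v where "v = z1 T"
  have v: "v \<ge> 0" using slope_nonneg by (simp add: v_def)
  have \<beta>: "\<beta> > 0" using \<alpha> by simp
  have low: "\<alpha> * T + \<delta> = arctan (\<alpha> * v)"
    unfolding v_def using low_frequency_phase[OF \<alpha> ab R(1) \<delta>] .
  have "sin (\<beta> * T + \<epsilon>) = \<beta> * v * cos (\<beta> * T + \<epsilon>)"
    unfolding v_def using ab by (intro mode[OF \<beta> _ _ R(1) \<epsilon>(1,2), of \<alpha>]) (auto simp: algebra_simps)
  then obtain k :: int where k: "\<beta> * T + \<epsilon> = arctan (\<beta> * v) + of_int k * pi"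
    by (rule sin_eq_mult_cos_imp_arctan)
  have "- pi < of_int k * pi"
  proof -
    have "0 < \<beta> * T + \<epsilon>" using \<beta> T_pos \<epsilon> by (simp add: add_pos_pos)
    then show ?thesis using k arctan_ubound[of "\<beta> * v"] pi_gt_zero by linarith
  qed
  then have "- 1 * pi < of_int k * pi" by simp
  then have "- 1 < (of_int k :: real)" using pi_gt_zero by (subst (asm) mult_less_cancel_right_pos) auto
  then have k0: "k \<ge> 0" by simp
  \<comment> \<open>From \<open>R \<le> 1\<close> and sin \<delta> \<le> \<delta>; together with
    arctan x \<le> x this gives T \<le> v - 2 p.\<close>
  have "2 * p * \<alpha> \<le> \<delta>"
  proof -
    have "2 * p * \<alpha> = R * sin \<delta>" using \<delta> by simp
    also have "\<dots> \<le> 1 * \<delta>" using R \<delta> by (intro mult_mono sin_x_le_x) (auto simp: sin_ge_zero)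
    finally show ?thesis by simp
  qed
  moreover have "arctan (\<alpha> * v) \<le> \<alpha> * v" using \<alpha> v by (intro arctan_le_self) auto
  ultimately have "\<alpha> * T \<le> \<alpha> * (v - 2 * p)" using low by (simp add: algebra_simps)
  then have Tv: "T \<le> v - 2 * p" using \<alpha> by simp
  have "\<beta>\<^sup>2 < c\<^sup>2" using ab \<alpha> by (simp flip: ab(1))
  then have \<beta>c: "\<beta> < c" using c_pos by (simp add: power2_less_imp_less)
  have "\<beta> * T \<le> c * (v - 2 * p)"
    using \<beta>c Tv \<beta> T_pos by (intro mult_mono) auto
  then have G: "\<beta> * T < c * (q - p + sqrt 2 * q * exp (p * (5 * pi / (4 * q))))"
    using slope_bound unfolding v_def by linarith
  have pi: "314159 / 100000 < pi" "pi < 31416 / 10000" using pi_approx by auto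
  have bT: "\<beta> * T \<le> \<beta> * v"
    using Tv \<beta> p_pos by (intro mult_left_mono) auto
  \<comment> \<open>If \<beta> v \<le> 10, then \<beta> T \<le> 10 suffices. Otherwise, for \<beta>
    < 1, one has \<epsilon> < pi/2 and \<beta> T < 18.7, which leaves a margin just under 0.15, so
    the arctangent is placed within 1/10 of pi/2. For \<beta> \<ge> 1, \<open>\<epsilon>\<close> may
    approach \<open>pi\<close>, but \<beta> T < 16.4 and the coarse bound pi/4 on the arctangent is
    enough.\<close>
  have "of_int k * pi < 6 * pi"
  proof (cases "\<beta> < 1")
    case True
    then have "\<epsilon> < pi / 2"
    proof -
      have "\<beta>\<^sup>2 < 1" using True \<beta> by (simp add: power_less_one_iff)
      then have "R * cos \<epsilon> > 0" using \<epsilon> by simp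
      then have c: "cos \<epsilon> > cos (pi / 2)" using R by (simp add: zero_less_mult_iff)
      show ?thesis
        using cos_monotone_0_pi_le[of "pi / 2" \<epsilon>] c \<epsilon> by (smt (verit) pi_half_ge_zero)
    qed
    show ?thesis
    proof (cases "\<beta> * v \<le> 10")
      case True
      have "arctan (\<beta> * v) \<ge> 0" using \<beta> v by simp
      then show ?thesis using k True bT \<open>\<epsilon> < pi / 2\<close> pi by linarith
    next
      case False
      have "pi / 2 - arctan (\<beta> * v) = arctan (inverse (\<beta> * v))"
        using False by (subst arctan_inverse) auto
      also have "\<dots> \<le> inverse (\<beta> * v)" using \<beta> v by (intro arctan_le_self) auto
      also have "\<dots> \<le> inverse 10" using False by (intro le_imp_inverse_le) auto
      finally have "pi / 2 - arctan (\<beta> * v) \<le> 1 / 10" by simp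
      then show ?thesis
        using k G speed_bound(1)[OF c_pos p_pos q_pos pq c2] \<open>\<epsilon> < pi / 2\<close> pi by linarith
    qed
  next
    case False
    then have "c \<ge> 1" using \<beta>c by simp
    note G' = speed_bound(2)[OF c_pos p_pos q_pos pq c2 this]
    show ?thesis
    proof (cases "\<beta> * v \<le> 10")
      case True
      have "arctan (\<beta> * v) \<ge> 0" using \<beta> v by simp
      then show ?thesis using k True bT \<epsilon> pi by linarith
    next
      case False
      then have "arctan (\<beta> * v) \<ge> arctan 1" by (subst arctan_le_iff) simp
      then have "arctan (\<beta> * v) \<ge> pi / 4" by (simp add: arctan_one)
      then show ?thesis using k G G' \<epsilon> pi by linarith
    qed
  qed
  then have "(of_int k :: real) < 6" using pi_gt_zero by (subst (asm) mult_less_cancel_right_pos) auto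
  then have "nat k < 6" using k0 by simp
  moreover have "real (nat k) = of_int k" using k0 by simp
  ultimately show ?thesis
    using that[of "nat k"] low k by (simp add: v_def)
qed

lemma wave_eq_profile:
  assumes \<alpha>: "0 < \<alpha>" "\<alpha> < \<beta>" and ab: "\<alpha>\<^sup>2 + \<beta>\<^sup>2 = c\<^sup>2" "\<alpha>\<^sup>2 * \<beta>\<^sup>2 = \<xi>"
    and R: "0 < R"
    and \<delta>: "R * cos \<delta> = 1 - \<alpha>\<^sup>2" "R * sin \<delta> = 2 * p * \<alpha>"
    and \<epsilon>: "R * cos \<epsilon> = 1 - \<beta>\<^sup>2" "R * sin \<epsilon> = 2 * p * \<beta>"
  shows "z t = wave_profile \<alpha> \<beta> p q R \<delta> \<epsilon> T (z1 T) \<bar>t\<bar>"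
proof -
  have "z t = z \<bar>t\<bar>" using even[of t] by (cases "t \<ge> 0") auto
  also have "\<dots> = wave_profile \<alpha> \<beta> p q R \<delta> \<epsilon> T (z1 T) \<bar>t\<bar>"
  proof (cases "\<bar>t\<bar> \<le> T")
    case True
    have "\<alpha>\<^sup>2 < \<beta>\<^sup>2" using \<alpha> by (intro power_strict_mono) auto
    then have "z \<bar>t\<bar> = ((z2 \<bar>t\<bar> + \<beta>\<^sup>2 * (z \<bar>t\<bar> + 1)) - (z2 \<bar>t\<bar> + \<alpha>\<^sup>2 * (z \<bar>t\<bar> + 1))) / (\<beta>\<^sup>2 - \<alpha>\<^sup>2) - 1"
      by (simp add: field_simps)
    also have "z2 \<bar>t\<bar> + \<beta>\<^sup>2 * (z \<bar>t\<bar> + 1) = 1 / \<alpha>\<^sup>2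
        - R * (cos (\<alpha> * T + \<delta>) + \<alpha> * z1 T * sin (\<alpha> * T + \<delta>)) / \<alpha>\<^sup>2 * cos (\<alpha> * \<bar>t\<bar>)"
      using True by (intro mode(2)[OF \<alpha>(1) ab R \<delta>]) auto
    also have "z2 \<bar>t\<bar> + \<alpha>\<^sup>2 * (z \<bar>t\<bar> + 1) = 1 / \<beta>\<^sup>2
        - R * (cos (\<beta> * T + \<epsilon>) + \<beta> * z1 T * sin (\<beta> * T + \<epsilon>)) / \<beta>\<^sup>2 * cos (\<beta> * \<bar>t\<bar>)"
      using True \<alpha> ab by (intro mode(2)[OF _ _ _ R \<epsilon>]) (auto simp: algebra_simps)
    finally show ?thesis using True by (simp add: wave_profile_def)
  next
    case False
    then show ?thesis using outer_profile[of "\<bar>t\<bar>"] by (simp add: wave_profile_def)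
  qed
  finally show ?thesis .
qed

end

section \<open>From travelling-wave solutions to the half-line description\<close>

lemma phase_exists:
  fixes x p R :: real
  assumes px: "p * x > 0" and R: "R > 0" "R\<^sup>2 = (1 - x\<^sup>2)\<^sup>2 + (2 * p * x)\<^sup>2"
  obtains \<delta> where "0 < \<delta>" "\<delta> < pi" "R * cos \<delta> = 1 - x\<^sup>2" "R * sin \<delta> = 2 * p * x"
proof -
  have "((1 - x\<^sup>2) / R)\<^sup>2 + (2 * p * x / R)\<^sup>2 = 1"
    using R(1) by (simp add: power_divide flip: add_divide_distrib R(2))
  then obtain \<delta> where \<delta>: "0 \<le> \<delta>" "\<delta> < 2 * pi" "(1 - x\<^sup>2) / R = cos \<delta>" "2 * p * x / R = sin \<delta>"
    by (rule sincos_total_2pi)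
  have "sin \<delta> > 0" using px R by (simp flip: \<delta>(4))
  then have "\<delta> \<noteq> 0" "\<delta> < pi" using \<delta>(1,2) sin_le_zero[of \<delta>] by (auto simp: not_less[symmetric])
  then show ?thesis using \<delta> R by (intro that[of \<delta>]) (auto simp: field_simps)
qed

lemma no_crossing:
  fixes z :: "real \<Rightarrow> real"
  assumes "continuous_on UNIV z" "\<And>t. a \<le> t \<Longrightarrow> t \<le> b \<Longrightarrow> z t \<noteq> m" "a \<le> b"
  shows "z a < m \<longleftrightarrow> z b < m"
  using assms IVT'[of z a m b] IVT2'[of z b m a] continuous_on_subset[OF assms(1), of "{a..b}"]
  by (metis linorder_not_less less_imp_le top_greatest)

lemma tw_solution_derivs:
  assumes "tw_solution c \<xi> z"
  shows "(z has_real_derivative deriv z t) (at t)"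
    "(deriv z has_real_derivative (deriv ^^ 2) z t) (at t)"
    "((deriv ^^ 2) z has_real_derivative (deriv ^^ 3) z t) (at t)"
    "((deriv ^^ 3) z has_real_derivative (deriv ^^ 4) z t) (at t)"
proof -
  have "((deriv ^^ k) z has_real_derivative (deriv ^^ Suc k) z t) (at t)" if "k < 4" for k
    using assms that unfolding tw_solution_def C4_def
    by (simp add: DERIV_deriv_iff_real_differentiable)
  from this[of 0] this[of 1] this[of 2] this[of 3] show
    "(z has_real_derivative deriv z t) (at t)"
    "(deriv z has_real_derivative (deriv ^^ 2) z t) (at t)"
    "((deriv ^^ 2) z has_real_derivative (deriv ^^ 3) z t) (at t)"
    "((deriv ^^ 3) z has_real_derivative (deriv ^^ 4) z t) (at t)"
    by (simp_all add: eval_nat_numeral)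
qed

text \<open>Evenness makes the two points opposite, and the sign of z + 1 is constant on each
  complementary interval. The limit at infinity settles the sign outside; inside, a wave that merely
  touches -1 from above has to be excluded.\<close>

lemma even_wave_of_tw_solution:
  assumes tw: "tw_solution c \<xi> z" and even: "even_fun z" and one: "one_troughed z"
    and c: "c > 0" and pq: "p > 0" "q > 0" "p\<^sup>2 + q\<^sup>2 = 1" and c2: "c\<^sup>2 = 2 - 4 * p\<^sup>2"
  obtains T where "even_wave c \<xi> p q T z (deriv z) ((deriv ^^ 2) z) ((deriv ^^ 3) z) ((deriv ^^ 4) z)"
proof -
  note d = tw_solution_derivs[OF tw]
  have ev: "z (- t) = z t" for t using even by (simp add: even_fun_def)
  have ode: "(deriv ^^ 4) z t + c\<^sup>2 * (deriv ^^ 2) z t + pos_part (z t + 1) - \<xi> * neg_part (z t + 1) - 1 = 0" for t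
    using tw by (simp add: tw_solution_def)
  have lim: "(z \<longlongrightarrow> 0) at_top" "(deriv z \<longlongrightarrow> 0) at_top"
    using tw by (auto simp: tw_solution_def)
  have cont: "continuous_on UNIV z"
    using d(1) by (intro continuous_at_imp_continuous_on ballI DERIV_isCont) blast
  obtain x y where xy: "{t. z t = -1} = {x, y}" "x \<noteq> y"
    using one by (auto simp: one_troughed_def card_2_iff)
  have neg: "- t \<in> {x, y}" if "t \<in> {x, y}" for t
    using that ev[of t] unfolding xy(1)[symmetric] by simp
  \<comment> \<open>Reflection permutes the two points; if it fixed both, both would be 0.\<close>
  have "- x = x \<or> - x = y" "- y = x \<or> - y = y" using neg[of x] neg[of y] by auto
  then have "y = - x" using xy(2) by (elim disjE) simp_all
  define T where "T = \<bar>x\<bar>"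
  have zero: "z t = - 1 \<longleftrightarrow> \<bar>t\<bar> = T" for t
  proof -
    have "z t = - 1 \<longleftrightarrow> t \<in> {x, y}" unfolding xy(1)[symmetric] by simp
    then show ?thesis using \<open>y = - x\<close> by (auto simp: T_def abs_if)
  qed
  have T: "T > 0" using \<open>y = - x\<close> xy(2) by (auto simp: T_def)
  have above: "z t > - 1" if "T < t" for t
  proof -
    have "\<forall>\<^sub>F s in at_top. z s > - 1"
      using lim(1) by (rule order_tendstoD) simp
    then obtain s where s: "t \<le> s" "z s > - 1"
      by (metis (mono_tags, lifting) eventually_at_top_linorder linorder_linear)
    have "z t < - 1 \<longleftrightarrow> z s < - 1"
      using s(1) that T by (intro no_crossing[OF cont]) (auto simp: zero)
    then show ?thesis using s(2) zero[of t] that T by auto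
  qed
  have inner: "z t < - 1 \<longleftrightarrow> z 0 < - 1" if "0 \<le> t" "t < T" for t
    using that by (subst no_crossing[OF cont, of 0 t]) (auto simp: zero)
  have "z 0 < - 1"
  proof (rule ccontr)
    assume "\<not> z 0 < - 1"
    have ge: "z t \<ge> - 1" for t
    proof -
      have "z t = z \<bar>t\<bar>" using ev[of t] by (cases "t \<ge> 0") auto
      then show ?thesis
        using inner[of "\<bar>t\<bar>"] above[of "\<bar>t\<bar>"] zero[of t] \<open>\<not> z 0 < - 1\<close> by fastforce
    qed
    \<comment> \<open>Without a trough the linear equation holds on the whole line, hence so does
      the factored one. Comparing it at t and -t leaves only the damping term, so z is constantly
      -1, against its limit.\<close>
    have lin: "(deriv ^^ 4) z t + (2 - 4 * p\<^sup>2) * (deriv ^^ 2) z t + z t = 0" for t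
      using ode[of t] ge[of t] c2 by (simp add: pos_part_def neg_part_def)
    have red: "(deriv ^^ 2) z t + 2 * p * deriv z t + z t = 0" for t
      using decaying_solution_factor(1)[OF d lin pq lim(2)] .
    have odd: "deriv z (- t) = - deriv z t" for t
      using deriv_reflection[OF d(1), of 1 t] ev by simp
    have ev2: "(deriv ^^ 2) z (- t) = (deriv ^^ 2) z t" for t
      using deriv_reflection[OF d(2), of "- 1" t] odd by simp
    have "2 * p * deriv z t = 0" for t
      using red[of t] red[of "- t"] unfolding odd ev ev2 by linarith
    then have "deriv z t = 0" for t using pq(1) by simp
    then have "z t = z T" for t
      using DERIV_isconst_all[of z t T] d(1) by metis
    then have "z = (\<lambda>t. - 1)" using zero[of T] T by auto
    then show False using lim(1) by (simp add: tendsto_const_iff)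
  qed
  have "even_wave c \<xi> p q T z (deriv z) ((deriv ^^ 2) z) ((deriv ^^ 3) z) ((deriv ^^ 4) z)"
  proof
    show "z t < - 1" if "0 \<le> t" "t < T" for t
      using inner[OF that] \<open>z 0 < - 1\<close> by simp
    then have le: "z t \<le> - 1" if "0 \<le> t" "t \<le> T" for t
      using that zero[of t] by (cases "t = T") fastforce+
    show "(deriv ^^ 4) z t + c\<^sup>2 * (deriv ^^ 2) z t + \<xi> * (z t + 1) = 1" if "0 \<le> t" "t \<le> T" for t
    proof -
      have parts: "pos_part (z t + 1) = 0" "neg_part (z t + 1) = - (z t + 1)"
        using le[OF that] by (simp_all add: pos_part_def neg_part_def)
      show ?thesis using ode[of t] unfolding parts by (simp add: algebra_simps)
    qed
    show "(deriv ^^ 4) z t + c\<^sup>2 * (deriv ^^ 2) z t + z t = 0" if "T \<le> t" for t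
    proof -
      have "z t \<ge> - 1" using that above[of t] zero[of t] T by (cases "t = T") auto
      then show ?thesis using ode[of t] by (simp add: pos_part_def neg_part_def)
    qed
  qed (use d ev lim T zero[of T] above c pq c2 in auto)
  then show ?thesis by (rule that)
qed

section \<open>Counting waves by branch number\<close>

theorem theorem4:
  fixes c \<xi> :: real
  assumes "0 < c" "c < sqrt 2" "0 < \<xi>" "\<xi> < c ^ 4 / 4"
  shows "finite {z. tw_solution c \<xi> z \<and> even_fun z \<and> one_troughed z}
       \<and> card {z. tw_solution c \<xi> z \<and> even_fun z \<and> one_troughed z} \<le> 6"
proof -
  define Z where "Z = {z. tw_solution c \<xi> z \<and> even_fun z \<and> one_troughed z}"
  have c2: "c\<^sup>2 < 2" using assms(1,2) by (metis less_imp_le real_less_rsqrt real_sqrt_less_iff real_sqrt_unique)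
  have c4: "c ^ 4 = c\<^sup>2 * c\<^sup>2" by (simp add: eval_nat_numeral)
  \<comment> \<open>The roots of s^4 + c^2 s^2 + 1 are \<plusminus>p \<plusminus> i q.\<close>
  define p where "p = sqrt ((2 - c\<^sup>2) / 4)"
  define q where "q = sqrt ((2 + c\<^sup>2) / 4)"
  have p2: "p\<^sup>2 = (2 - c\<^sup>2) / 4" and q2: "q\<^sup>2 = (2 + c\<^sup>2) / 4"
    using c2 by (simp_all add: p_def q_def)
  have pq: "p > 0" "q > 0" "p\<^sup>2 + q\<^sup>2 = 1" "c\<^sup>2 = 2 - 4 * p\<^sup>2"
    using c2 unfolding p2 q2 by (auto simp: p_def q_def add_pos_nonneg field_simps)
  \<comment> \<open>\<open>D\<close> is the root of the discriminant of s^2 - c^2 s + \<xi>, whose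
    zeros are \<alpha>^2 and \<beta>^2; the bounds on \<open>\<xi>\<close> make them distinct and
    positive.\<close>
  define D where "D = sqrt (c ^ 4 - 4 * \<xi>)"
  have D: "D > 0" "D\<^sup>2 = c ^ 4 - 4 * \<xi>" using assms(4) by (auto simp: D_def)
  have "D\<^sup>2 < (c\<^sup>2)\<^sup>2" using D assms(3) by (simp add: c4 power2_eq_square)
  then have Dc: "D < c\<^sup>2" by (rule power2_less_imp_less) simp
  define \<alpha> where "\<alpha> = sqrt ((c\<^sup>2 - D) / 2)"
  define \<beta> where "\<beta> = sqrt ((c\<^sup>2 + D) / 2)"
  have a2: "\<alpha>\<^sup>2 = (c\<^sup>2 - D) / 2" and b2: "\<beta>\<^sup>2 = (c\<^sup>2 + D) / 2"
    using Dc D by (simp_all add: \<alpha>_def \<beta>_def)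
  have \<alpha>: "0 < \<alpha>" "\<alpha> < \<beta>" using Dc D by (auto simp: \<alpha>_def \<beta>_def)
  have ab: "\<alpha>\<^sup>2 + \<beta>\<^sup>2 = c\<^sup>2" "\<alpha>\<^sup>2 * \<beta>\<^sup>2 = \<xi>"
    unfolding a2 b2 using D(2) by (simp_all add: field_simps c4 power2_eq_square)
  \<comment> \<open>One modulus serves both phases: (1 - x^2)^2 + (2 p x)^2 = 1 - x^2 (c^2 - x^2) =
    1 - \<xi> for either frequency x.\<close>
  define R where "R = sqrt (1 - \<xi>)"
  have "c\<^sup>2 * c\<^sup>2 < 2 * 2" using mult_strict_mono[OF c2 c2] by simp
  then have "\<xi> < 1" using assms(4) unfolding c4 by linarith
  then have R: "0 < R" "R \<le> 1" "R\<^sup>2 = 1 - \<xi>" using assms(3) by (auto simp: R_def)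
  have R_eq: "R\<^sup>2 = (1 - x\<^sup>2)\<^sup>2 + (2 * p * x)\<^sup>2" if "x\<^sup>2 + y\<^sup>2 = c\<^sup>2" "x\<^sup>2 * y\<^sup>2 = \<xi>" for x y
  proof -
    have "(2 * p * x)\<^sup>2 = (2 - (x\<^sup>2 + y\<^sup>2)) * x\<^sup>2"
      using p2 that(1) by (simp add: power_mult_distrib)
    then show ?thesis
      unfolding R(3) that(2)[symmetric] by (simp add: algebra_simps power2_eq_square)
  qed
  obtain \<delta> where \<delta>: "0 < \<delta>" "\<delta> < pi" "R * cos \<delta> = 1 - \<alpha>\<^sup>2" "R * sin \<delta> = 2 * p * \<alpha>"
    by (rule phase_exists[OF mult_pos_pos[OF pq(1) \<alpha>(1)] R(1) R_eq[OF ab]])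
  have ba: "\<beta>\<^sup>2 + \<alpha>\<^sup>2 = c\<^sup>2" "\<beta>\<^sup>2 * \<alpha>\<^sup>2 = \<xi>" and "\<beta> > 0"
    using ab \<alpha> by (simp_all add: algebra_simps)
  obtain \<epsilon> where \<epsilon>: "0 < \<epsilon>" "\<epsilon> < pi" "R * cos \<epsilon> = 1 - \<beta>\<^sup>2" "R * sin \<epsilon> = 2 * p * \<beta>"
    by (rule phase_exists[OF mult_pos_pos[OF pq(1) \<open>\<beta> > 0\<close>] R(1) R_eq[OF ba]])
  have "\<alpha>\<^sup>2 < 1" using c2 D(1) by (simp add: a2)
  then have "cos \<delta> > 0" using \<delta>(3) R(1) by (smt (verit) zero_less_mult_pos)
  then have \<delta>_half: "\<delta> < pi / 2"
    using cos_monotone_0_pi_le[of "pi / 2" \<delta>] \<delta>(2) pi_half_ge_zero by (cases "\<delta> < pi / 2") auto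
  define branch where "branch z k T v \<longleftrightarrow> k < 6 \<and> 0 \<le> v \<and> \<alpha> * T + \<delta> = arctan (\<alpha> * v)
      \<and> \<beta> * T + \<epsilon> = arctan (\<beta> * v) + real k * pi
      \<and> z = (\<lambda>t. wave_profile \<alpha> \<beta> p q R \<delta> \<epsilon> T v \<bar>t\<bar>)" for z k T v
  have "\<forall>z \<in> Z. \<exists>k T v. branch z k T v"
  proof
    fix z assume "z \<in> Z"
    then have "tw_solution c \<xi> z" "even_fun z" "one_troughed z" by (simp_all add: Z_def)
    then obtain T where "even_wave c \<xi> p q T z (deriv z) ((deriv ^^ 2) z) ((deriv ^^ 3) z) ((deriv ^^ 4) z)"
      using even_wave_of_tw_solution assms(1) pq by blast
    then interpret even_wave c \<xi> p q T z "deriv z" "(deriv ^^ 2) z" "(deriv ^^ 3) z" "(deriv ^^ 4) z" .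
    obtain k where "k < 6" "\<alpha> * T + \<delta> = arctan (\<alpha> * deriv z T)"
      "\<beta> * T + \<epsilon> = arctan (\<beta> * deriv z T) + real k * pi"
      by (rule wave_branch[OF \<alpha> ab R(1,2) \<delta>(3,4,1) \<delta>_half \<epsilon>(3,4,1,2)])
    moreover have "z = (\<lambda>t. wave_profile \<alpha> \<beta> p q R \<delta> \<epsilon> T (deriv z T) \<bar>t\<bar>)"
      using wave_eq_profile[OF \<alpha> ab R(1) \<delta>(3,4) \<epsilon>(3,4)] by (rule ext)
    ultimately show "\<exists>k T v. branch z k T v"
      unfolding branch_def using slope_nonneg by blast
  qed
  then obtain k where k: "\<And>z. z \<in> Z \<Longrightarrow> \<exists>T v. branch z (k z) T v"
    using bchoice[of Z "\<lambda>z k. \<exists>T v. branch z k T v"] by blast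
  have unique: "z = w" if zw: "branch z j T v" "branch w j T' v'" for z w j T v T' v'
  proof -
    \<comment> \<open>Dividing the phase relations by \<open>\<alpha>\<close> and
      \<open>\<beta>\<close> and subtracting eliminates \<open>T\<close>.\<close>
    have gap: "arctan (\<alpha> * v) / \<alpha> - arctan (\<beta> * v) / \<beta> = \<delta> / \<alpha> - \<epsilon> / \<beta> + real j * pi / \<beta>"
      if "branch z j T v" for z T v
    proof -
      have "arctan (\<alpha> * v) / \<alpha> = T + \<delta> / \<alpha>" "arctan (\<beta> * v) / \<beta> = T + \<epsilon> / \<beta> - real j * pi / \<beta>"
        using that \<alpha> by (auto simp: branch_def field_simps)
      then show ?thesis by simp
    qed
    have "\<not> v < v'" "\<not> v' < v"
      using arctan_scaled_difference_strict_mono[OF \<alpha>, of v v']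
        arctan_scaled_difference_strict_mono[OF \<alpha>, of v' v] gap[OF zw(1)] gap[OF zw(2)] zw
      by (auto simp: branch_def)
    then have "v = v'" by simp
    then have "\<alpha> * T + \<delta> = \<alpha> * T' + \<delta>" using zw by (simp add: branch_def)
    then have "T = T'" using \<alpha> by simp
    with \<open>v = v'\<close> show "z = w" using zw by (simp add: branch_def)
  qed
  have inj: "inj_on k Z"
    using k unique by (metis inj_onI)
  \<comment> \<open>Branch numbers start at 0, so there are six of them.\<close>
  have "k ` Z \<subseteq> {..<6}" using k by (auto simp: branch_def)
  then have "finite Z" "card Z \<le> card {..<6::nat}"
    using inj_on_finite[OF inj] card_inj_on_le[OF inj] by blast+
  then show ?thesis by (simp add: Z_def)
qed

end
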